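(* Let $f:\mathbb{N}\to\mathbb{C}$ be a complex-valued arithmetic function. Assume that $$\sum_{n\leq x}|f(n)|^{2}\ll x^{\eta}$$ with some fixed $\eta\in(0,2)$. Then $$S_{f}(x)=C_{f}\,x+O\left(x^{(2+3\eta)/8}\right),$$ where $$S_f(x)=\sum_{n\leq x}f\left(\left[\frac{x}{n}\right]\right),\qquad C_{f}=\sum_{n=1}^{\infty}\frac{f(n)}{n(n+1)}.$$
   Context: Here $[t]$ denotes the floor (greatest integer) of the real number $t$, $\mathbb{N}=\{1,2,3,\dots\}$, and sums over $n\le x$ run over positive integers. The asymptotic formula is for $x\to\infty$; the notations $\ll$ and $O$ have implied constants independent of $x$ (they may depend on $f$ and $\eta$). *)

theory Defs
  imports Complex_Main "HOL-Library.Landau_Symbols"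
begin

text \<open>
  An arithmetic function on the positive integers is a function on \<^typ>\<open>nat\<close> whose value
  at 0 is irrelevant: for \<open>1 \<le> n \<le> x\<close> we have \<open>x / n \<ge> 1\<close>, so 0 is never an argument below.
\<close>

definition floor_quotient_sum :: "(nat \<Rightarrow> complex) \<Rightarrow> real \<Rightarrow> complex" where
  "floor_quotient_sum f x = (\<Sum>n\<in>{1..nat \<lfloor>x\<rfloor>}. f (nat \<lfloor>x / real n\<rfloor>))"

text \<open>The term with index \<open>n\<close> is the one usually written with index \<open>n + 1\<close>, as series in HOL start at 0.\<close>

definition main_coeff_term :: "(nat \<Rightarrow> complex) \<Rightarrow> nat \<Rightarrow> complex" where
  "main_coeff_term f n = f (n + 1) / (of_nat (n + 1) * of_nat (n + 2))"

definition main_coeff :: "(nat \<Rightarrow> complex) \<Rightarrow> complex" where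
  "main_coeff f = (\<Sum>n. main_coeff_term f n)"

end

theory Submission
  imports Defs "HOL-Analysis.Analysis"
begin

text \<open>
  The sum is split by the size of the quotient \<open>\<lfloor>x / n\<rfloor>\<close>, at height \<open>\<surd>x\<close>. A value \<open>d\<close> is taken by
  \<open>x / d - x / (d + 1) + O(1)\<close> integers \<open>n\<close>, with an error of at most 1
  (\<open>card_floor_quotient_eq\<close>). A quotient above \<open>\<surd>x\<close> forces \<open>n < \<surd>x\<close>, and on that range different
  \<open>n\<close> have different quotients (\<open>inj_on_floor_quotient\<close>). Hence the distance between \<open>S\<^sub>f(x)\<close> and
  \<open>C\<^sub>f x\<close> is at most the sum of
    \<^item> \<open>\<Sum>\<^bsub>d \<le> \<surd>x\<^esub> \<bar>f d\<bar>\<close>, from the counting errors,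
    \<^item> \<open>\<Sum>\<^bsub>n < \<surd>x\<^esub> \<bar>f \<lfloor>x / n\<rfloor>\<bar>\<close>, from the large quotients,
    \<^item> \<open>x \<Sum>\<^bsub>d > \<surd>x\<^esub> \<bar>f d\<bar> / (d (d + 1))\<close>, the part of \<open>C\<^sub>f x\<close> beyond height \<open>\<surd>x\<close>.

  Cauchy-Schwarz turns the mean square hypothesis into \<open>\<Sum>\<^bsub>d \<le> y\<^esub> \<bar>f d\<bar> = O(y\<^bsup>(1 + \<eta>)/2\<^esup>)\<close>, so the first
  sum is \<open>O(x\<^bsup>(1 + \<eta>)/4\<^esup>)\<close>, and by partial summation so is the third. As the quotients in the second
  sum are distinct, Cauchy-Schwarz bounds it on each dyadic range \<open>n \<sim> N\<close> by a multiple of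
  \<open>N\<^bsup>1/2\<^esup> (x/N)\<^bsup>\<eta>/2\<^esup>\<close>, which for \<open>N \<le> \<surd>x\<close> is at most the larger of \<open>x\<^bsup>(1 + \<eta>)/4\<^esup>\<close> and \<open>x\<^bsup>\<eta>/2\<^esup>\<close>.
  For \<open>0 < \<eta> < 2\<close> both \<open>(1 + \<eta>)/4\<close> and \<open>\<eta>/2\<close> are strictly smaller than \<open>(2 + 3\<eta>)/8\<close>. This leaves
  room to replace dyadic ranges by power weights: \<open>large_quotients_bound\<close> uses the convergent series
  \<open>\<Sum> \<bar>f m\<bar>\<^sup>2 m\<^bsup>-s\<^esup>\<close> and \<open>\<Sum> n\<^bsup>-t\<^esup>\<close> with \<open>s > \<eta>\<close> and \<open>t > 1\<close>, and \<open>main_coeff_tail_bound\<close> uses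
  \<open>\<Sum> \<bar>f m\<bar> m\<^bsup>-s\<^esup>\<close> with \<open>s > (1 + \<eta>)/2\<close>.
\<close>

section \<open>Power moments from bounds on partial sums\<close>

lemma powr_minus_diff_le:
  fixes s :: real
  assumes "s \<ge> 0" "k > 0"
  shows "k powr (-s) - (k + 1) powr (-s) \<le> s * k powr (-s - 1)"
proof -
  have "\<exists>z>k. z < k + 1 \<and> (k + 1) powr (-s) - k powr (-s) = (k + 1 - k) * ((-s) * z powr (-s - 1))"
    using assms by (intro MVT2) (auto intro!: derivative_eq_intros)
  then obtain z where z: "z > k" "(k + 1) powr (-s) - k powr (-s) = (-s) * z powr (-s - 1)"
    by auto
  have "z powr (-s - 1) \<le> k powr (-s - 1)"
    using z assms by (intro powr_mono2') auto
  hence "s * z powr (-s - 1) \<le> s * k powr (-s - 1)"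
    using assms by (intro mult_left_mono)
  thus ?thesis using z by linarith
qed

text \<open>
  Partial summation: with \<open>A\<close> the summatory function of \<open>a\<close>, the weighted sum is controlled by
  \<open>\<Sum> A k (k\<^bsup>-s\<^esup> - (k + 1)\<^bsup>-s\<^esup>)\<close>, whose terms are \<open>O(k\<^bsup>\<theta> - s - 1\<^esup>)\<close>.
\<close>

lemma summable_weighted_of_partial_sum_bound:
  fixes a :: "nat \<Rightarrow> real"
  assumes nonneg: "\<And>m. a m \<ge> 0"
    and bound: "\<And>n. n \<ge> 1 \<Longrightarrow> (\<Sum>m=1..n. a m) \<le> K * real n powr \<theta>"
    and "0 \<le> \<theta>" "\<theta> < s"
  shows "summable (\<lambda>m. a m * real m powr (-s))"
proof -
  define A where "A = (\<lambda>n. \<Sum>m=1..n. a m)"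
  have K: "K \<ge> 0" using bound[of 1] nonneg[of 1] by simp
  have A_nonneg: "A n \<ge> 0" for n unfolding A_def by (intro sum_nonneg nonneg)
  have A_bound: "A n \<le> K * real n powr \<theta>" for n
    using bound[of n] by (cases "n = 0") (auto simp: A_def)
  have parts: "(\<Sum>m=1..M. a m * real m powr (-s)) =
      A M * real (M + 1) powr (-s) + (\<Sum>k=1..M. A k * (real k powr (-s) - (real k + 1) powr (-s)))" for M
    by (induction M) (simp_all add: A_def algebra_simps)
  define Z where "Z = (\<Sum>k. real k powr (\<theta> - s - 1))"
  have sZ: "summable (\<lambda>k. real k powr (\<theta> - s - 1))"
    using assms by (subst summable_real_powr_iff) auto
  have le: "(\<Sum>m=1..M. a m * real m powr (-s)) \<le> K + K * s * Z" for M
  proof -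
    have "A M * real (M + 1) powr (-s) \<le> (K * real (M + 1) powr \<theta>) * real (M + 1) powr (-s)"
      using K \<open>0 \<le> \<theta>\<close>
      by (intro mult_right_mono order.trans[OF A_bound] mult_left_mono powr_mono2) auto
    also have "\<dots> = K * real (M + 1) powr (\<theta> - s)"
      by (simp add: powr_diff powr_minus field_simps)
    also have "\<dots> \<le> K * 1"
      using K assms powr_mono[of "\<theta> - s" 0 "real (M + 1)"] by (intro mult_left_mono) auto
    finally have 1: "A M * real (M + 1) powr (-s) \<le> K" by simp
    have "(\<Sum>k=1..M. A k * (real k powr (-s) - (real k + 1) powr (-s)))
        \<le> (\<Sum>k=1..M. K * s * real k powr (\<theta> - s - 1))"
    proof (rule sum_mono)
      fix k assume k: "k \<in> {1..M}"
      have "A k * (real k powr (-s) - (real k + 1) powr (-s)) \<le> A k * (s * real k powr (-s - 1))"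
        using k assms by (intro mult_left_mono powr_minus_diff_le A_nonneg) auto
      also have "\<dots> \<le> (K * real k powr \<theta>) * (s * real k powr (-s - 1))"
        using assms by (intro mult_right_mono A_bound) auto
      also have "\<dots> = K * s * (real k powr \<theta> * real k powr (-s - 1))" by simp
      also have "real k powr \<theta> * real k powr (-s - 1) = real k powr (\<theta> - s - 1)"
        by (simp add: algebra_simps flip: powr_add)
      finally show "A k * (real k powr (-s) - (real k + 1) powr (-s)) \<le> K * s * real k powr (\<theta> - s - 1)" .
    qed
    also have "\<dots> = K * s * (\<Sum>k=1..M. real k powr (\<theta> - s - 1))"
      by (simp add: sum_distrib_left)
    also have "\<dots> \<le> K * s * Z"
      unfolding Z_def using K assms sZ by (intro mult_left_mono sum_le_suminf) auto
    finally show ?thesis unfolding parts using 1 by linarith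
  qed
  show ?thesis
  proof (rule summableI_nonneg_bounded)
    fix n
    have "(\<Sum>i<n. a i * real i powr (-s)) \<le> (\<Sum>m\<in>{0..n}. a m * real m powr (-s))"
      using nonneg by (intro sum_mono2) auto
    also have "\<dots> = (\<Sum>m=1..n. a m * real m powr (-s))"
      by (simp add: sum.atLeast_Suc_atMost)
    also note le
    finally show "(\<Sum>i<n. a i * real i powr (-s)) \<le> K + K * s * Z" .
  qed (use nonneg in auto)
qed

text \<open>
  Only finitely many \<open>n\<close> lie below the threshold \<open>N\<close> of the asymptotic bound. For a uniform constant,
  the sum up to \<open>n\<close> is enlarged to one up to \<open>n + N \<le> (N + 1) n\<close>, where the bound applies.
\<close>

lemma partial_sum_bound_of_bigo:
  fixes a :: "nat \<Rightarrow> real"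
  assumes nonneg: "\<And>m. a m \<ge> 0" and "\<eta> \<ge> 0"
    and "(\<lambda>x::real. \<Sum>n\<in>{1..nat \<lfloor>x\<rfloor>}. a n) \<in> O[at_top](\<lambda>x. x powr \<eta>)"
  obtains K where "K \<ge> 0" "\<And>n. n \<ge> 1 \<Longrightarrow> (\<Sum>m=1..n. a m) \<le> K * real n powr \<eta>"
proof -
  from assms(3) obtain c where c: "c > 0"
    "\<forall>\<^sub>F x in at_top. norm (\<Sum>n\<in>{1..nat \<lfloor>x::real\<rfloor>}. a n) \<le> c * norm (x powr \<eta>)"
    by (elim landau_o.bigE) blast
  from c(2) obtain x0 where x0:
    "\<And>x::real. x \<ge> x0 \<Longrightarrow> norm (\<Sum>n\<in>{1..nat \<lfloor>x\<rfloor>}. a n) \<le> c * norm (x powr \<eta>)"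
    by (auto simp: eventually_at_top_linorder)
  define N where "N = nat \<lceil>x0\<rceil>"
  have N: "real N \<ge> x0" unfolding N_def by linarith
  show ?thesis
  proof (rule that[of "c * real (N + 1) powr \<eta>"])
    fix n :: nat assume n: "n \<ge> 1"
    have "(\<Sum>m=1..n. a m) \<le> (\<Sum>m=1..n + N. a m)"
      using nonneg by (intro sum_mono2) auto
    also have "\<dots> \<le> c * real (n + N) powr \<eta>"
      using x0[of "real (n + N)"] N nonneg by (simp add: floor_of_nat flip: of_nat_add)
    also have "\<dots> \<le> c * (real (N + 1) * real n) powr \<eta>"
    proof -
      have "N \<le> N * n" using n by simp
      hence "n + N \<le> (N + 1) * n" by simp
      hence "real (n + N) \<le> real (N + 1) * real n" by (metis of_nat_le_iff of_nat_mult)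
      thus ?thesis using c \<open>\<eta> \<ge> 0\<close> by (intro mult_left_mono powr_mono2) auto
    qed
    also have "\<dots> = c * real (N + 1) powr \<eta> * real n powr \<eta>"
      by (subst powr_mult) auto
    finally show "(\<Sum>m=1..n. a m) \<le> c * real (N + 1) powr \<eta> * real n powr \<eta>" .
  qed (use c in auto)
qed

lemma first_moment_le:
  fixes a :: "nat \<Rightarrow> real"
  assumes "\<And>m. a m \<ge> 0" "(\<Sum>m=1..n. (a m)\<^sup>2) \<le> K * real n powr \<eta>" "K \<ge> 0"
  shows "(\<Sum>m=1..n. a m) \<le> sqrt K * real n powr ((1 + \<eta>) / 2)"
proof (rule power2_le_imp_le)
  have "(\<Sum>m=1..n. a m)\<^sup>2 \<le> (\<Sum>m=1..n. (a m)\<^sup>2) * (\<Sum>m=1..n. 1\<^sup>2)"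
    using Cauchy_Schwarz_ineq_sum[of a "\<lambda>_. 1" "{1..n}"] by simp
  also have "\<dots> \<le> (K * real n powr \<eta>) * real n"
    using assms by (simp add: mult_right_mono)
  also have "\<dots> = (sqrt K * real n powr ((1 + \<eta>) / 2))\<^sup>2"
  proof -
    have "(real n powr ((1 + \<eta>) / 2))\<^sup>2 = real n powr (1 + \<eta>)"
      by (simp add: power2_eq_square flip: powr_add)
    also have "\<dots> = real n * real n powr \<eta>"
      by (simp add: powr_add)
    finally show ?thesis using assms by (simp add: power_mult_distrib)
  qed
  finally show "(\<Sum>m=1..n. a m)\<^sup>2 \<le> (sqrt K * real n powr ((1 + \<eta>) / 2))\<^sup>2" .
qed (use assms in auto)

section \<open>Multiplicities of the quotients\<close>

text \<open>
  The integers \<open>n\<close> with quotient \<open>d\<close> are those in the interval from \<open>x / (d + 1)\<close> (exclusive) to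
  \<open>x / d\<close> (inclusive), whose length is \<open>x / (d (d + 1))\<close>.
\<close>

lemma card_floor_quotient_eq:
  fixes x :: real
  assumes "d \<ge> 1" "x \<ge> 1"
  shows "\<bar>real (card {n\<in>{1..nat \<lfloor>x\<rfloor>}. nat \<lfloor>x / real n\<rfloor> = d}) - x / (real d * (real d + 1))\<bar> \<le> 1"
proof -
  define p q where "p = nat \<lfloor>x / (real d + 1)\<rfloor>" and "q = nat \<lfloor>x / real d\<rfloor>"
  have "{n\<in>{1..nat \<lfloor>x\<rfloor>}. nat \<lfloor>x / real n\<rfloor> = d} = {p<..q}"
  proof (intro set_eqI)
    fix n
    show "n \<in> {n\<in>{1..nat \<lfloor>x\<rfloor>}. nat \<lfloor>x / real n\<rfloor> = d} \<longleftrightarrow> n \<in> {p<..q}"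
    proof (cases "n = 0")
      case False
      have "nat \<lfloor>x / real n\<rfloor> = d \<longleftrightarrow> real d \<le> x / real n \<and> x / real n < real d + 1"
        using assms by (auto simp: nat_eq_iff floor_eq_iff)
      also have "\<dots> \<longleftrightarrow> real n \<le> x / real d \<and> x / (real d + 1) < real n"
        using False assms by (simp add: field_simps)
      also have "\<dots> \<longleftrightarrow> n \<in> {p<..q}"
        using assms False by (auto simp: p_def q_def le_nat_floor nat_less_iff floor_less_iff le_nat_iff le_floor_iff)
      finally have *: "nat \<lfloor>x / real n\<rfloor> = d \<longleftrightarrow> n \<in> {p<..q}" .
      have "n \<le> nat \<lfloor>x\<rfloor>" if "n \<in> {p<..q}"
      proof -
        have "x / real d \<le> x" using assms by (simp add: field_simps mult_le_cancel_left1)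
        hence "q \<le> nat \<lfloor>x\<rfloor>" unfolding q_def by (intro nat_mono floor_mono)
        thus ?thesis using that by simp
      qed
      thus ?thesis using * False by auto
    qed auto
  qed
  hence card: "card {n\<in>{1..nat \<lfloor>x\<rfloor>}. nat \<lfloor>x / real n\<rfloor> = d} = q - p" by simp
  have "x / (real d + 1) \<le> x / real d" using assms by (intro divide_left_mono) auto
  hence "p \<le> q" unfolding p_def q_def by (intro nat_mono floor_mono)
  hence "real (q - p) = real q - real p" by simp
  moreover have "real q \<le> x / real d" "real q > x / real d - 1"
    "real p \<le> x / (real d + 1)" "real p > x / (real d + 1) - 1"
    using assms unfolding p_def q_def by (simp_all add: of_nat_nat)
  moreover have "x / (real d * (real d + 1)) = x / real d - x / (real d + 1)"
    using assms by (simp add: field_simps)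
  ultimately show ?thesis unfolding card by linarith
qed

text \<open>
  For \<open>m < n < \<surd>x\<close> the gap \<open>x / m - x / n = x (n - m) / (m n)\<close> exceeds 1, so the floors differ.
\<close>

lemma inj_on_floor_quotient:
  fixes x :: real
  shows "inj_on (\<lambda>n. nat \<lfloor>x / real n\<rfloor>) {n. 1 \<le> n \<and> real n < sqrt x}"
proof (rule linorder_inj_onI)
  fix m n :: nat
  assume mn: "m < n" "m \<in> {n. 1 \<le> n \<and> real n < sqrt x}" "n \<in> {n. 1 \<le> n \<and> real n < sqrt x}"
  have "0 < sqrt x" using mn(2) of_nat_0_le_iff[of m] le_less_trans by blast
  hence x: "x > 0" by simp
  have "real m * real n < sqrt x * sqrt x" using mn x by (intro mult_strict_mono) auto
  hence "real m * real n < x" using x by simp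
  hence "1 < x / (real m * real n)" using mn by (simp add: field_simps)
  also have "\<dots> \<le> (real n - real m) * (x / (real m * real n))"
    using mn x mult_right_mono[of 1 "real n - real m" "x / (real m * real n)"] by simp
  also have "\<dots> = x / real m - x / real n" using mn by (simp add: field_simps)
  finally have "\<lfloor>x / real n\<rfloor> < \<lfloor>x / real m\<rfloor>" by linarith
  moreover have "0 \<le> \<lfloor>x / real n\<rfloor>" using x by simp
  ultimately show "nat \<lfloor>x / real m\<rfloor> \<noteq> nat \<lfloor>x / real n\<rfloor>" by linarith
qed (auto simp: linorder_linear)

section \<open>Splitting at the square root\<close>

text \<open>
  Grouping the terms with quotient at most \<open>D\<close> by their quotient replaces each multiplicity by its
  expected value at a cost of \<open>\<bar>f d\<bar>\<close>. The remaining terms have \<open>x / n \<ge> D + 1 > \<surd>x\<close>, hence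
  \<open>n < \<surd>x\<close>, and are bounded trivially.
\<close>

lemma floor_quotient_sum_approx:
  fixes x :: real
  assumes x: "x \<ge> 1" and D: "sqrt x < real D + 1"
  shows "cmod (floor_quotient_sum f x - (\<Sum>d=1..D. f d / (of_nat d * of_nat (d + 1))) * of_real x)
    \<le> (\<Sum>d=1..D. cmod (f d)) + (\<Sum>n | 1 \<le> n \<and> real n < sqrt x. cmod (f (nat \<lfloor>x / real n\<rfloor>)))"
proof -
  define I where "I = {1..nat \<lfloor>x\<rfloor>}"
  define q where "q = (\<lambda>n. nat \<lfloor>x / real n\<rfloor>)"
  define c where "c = (\<lambda>d. card {n\<in>I. q n = d})"
  have fin: "finite I" by (simp add: I_def)
  have finB: "finite {n. 1 \<le> n \<and> real n < sqrt x}"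
    by (rule finite_subset[of _ "{..nat \<lceil>sqrt x\<rceil>}"]) (auto, linarith)
  have "floor_quotient_sum f x = (\<Sum>n\<in>I. f (q n))"
    by (simp add: floor_quotient_sum_def I_def q_def)
  also have "\<dots> = (\<Sum>n\<in>{n\<in>I. q n \<in> {1..D}}. f (q n)) + (\<Sum>n\<in>{n\<in>I. q n \<notin> {1..D}}. f (q n))"
    using fin by (subst sum.union_disjoint[symmetric]) (auto intro!: sum.cong)
  also have "(\<Sum>n\<in>{n\<in>I. q n \<in> {1..D}}. f (q n)) = (\<Sum>d=1..D. \<Sum>n\<in>{n\<in>{n\<in>I. q n \<in> {1..D}}. q n = d}. f (q n))"
    using fin by (intro sum.group[symmetric]) auto
  also have "\<dots> = (\<Sum>d=1..D. of_nat (c d) * f d)"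
  proof (rule sum.cong)
    fix d assume d: "d \<in> {1..D}"
    have "(\<Sum>n\<in>{n\<in>{n\<in>I. q n \<in> {1..D}}. q n = d}. f (q n)) = (\<Sum>n\<in>{n\<in>I. q n = d}. f d)"
      using d by (intro sum.cong) auto
    thus "(\<Sum>n\<in>{n\<in>{n\<in>I. q n \<in> {1..D}}. q n = d}. f (q n)) = of_nat (c d) * f d"
      by (simp add: c_def)
  qed auto
  finally have S: "floor_quotient_sum f x =
    (\<Sum>d=1..D. of_nat (c d) * f d) + (\<Sum>n\<in>{n\<in>I. q n \<notin> {1..D}}. f (q n))" .
  have "cmod (\<Sum>n\<in>{n\<in>I. q n \<notin> {1..D}}. f (q n)) \<le> (\<Sum>n\<in>{n\<in>I. q n \<notin> {1..D}}. cmod (f (q n)))"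
    by (rule norm_sum)
  also have "\<dots> \<le> (\<Sum>n | 1 \<le> n \<and> real n < sqrt x. cmod (f (q n)))"
  proof (rule sum_mono2[OF finB])
    show "{n\<in>I. q n \<notin> {1..D}} \<subseteq> {n. 1 \<le> n \<and> real n < sqrt x}"
    proof safe
      fix n assume n: "n \<in> I" "q n \<notin> {1..D}"
      have n1: "n \<ge> 1" "real n \<le> x" using n x by (auto simp: I_def le_nat_iff le_floor_iff)
      thus "1 \<le> n" by simp
      have "x / real n \<ge> 1" using n1 by simp
      hence "q n \<ge> 1" unfolding q_def by (simp add: le_nat_iff)
      hence "q n \<ge> D + 1" using n by auto
      hence "real D + 1 \<le> real (q n)" by simp
      also have "\<dots> \<le> x / real n" unfolding q_def using x by (simp add: of_nat_nat)
      finally have "sqrt x < x / real n" using D by linarith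
      hence "sqrt x * real n < sqrt x * sqrt x" using n1 x by (simp add: field_simps)
      thus "real n < sqrt x" by (rule mult_left_less_imp_less) (use x in simp)
    qed
  qed auto
  finally have 1: "cmod (\<Sum>n\<in>{n\<in>I. q n \<notin> {1..D}}. f (q n))
    \<le> (\<Sum>n | 1 \<le> n \<and> real n < sqrt x. cmod (f (q n)))" .
  have "(\<Sum>d=1..D. of_nat (c d) * f d) - (\<Sum>d=1..D. f d / (of_nat d * of_nat (d + 1))) * of_real x
     = (\<Sum>d=1..D. of_real (real (c d) - x / (real d * (real d + 1))) * f d)"
    by (simp add: sum_distrib_right flip: sum_subtractf) (simp add: algebra_simps)
  also have "cmod \<dots> \<le> (\<Sum>d=1..D. 1 * cmod (f d))"
  proof (rule sum_norm_le)
    fix d assume "d \<in> {1..D}"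
    hence "\<bar>real (c d) - x / (real d * (real d + 1))\<bar> \<le> 1"
      using card_floor_quotient_eq[of d x] x by (simp add: c_def I_def q_def)
    thus "cmod (of_real (real (c d) - x / (real d * (real d + 1))) * f d) \<le> 1 * cmod (f d)"
      unfolding norm_mult norm_of_real by (intro mult_right_mono) auto
  qed
  finally have 2: "cmod ((\<Sum>d=1..D. of_nat (c d) * f d)
      - (\<Sum>d=1..D. f d / (of_nat d * of_nat (d + 1))) * of_real x) \<le> (\<Sum>d=1..D. cmod (f d))"
    by simp
  show ?thesis
    unfolding S using 1 2 norm_triangle_ineq[of "(\<Sum>d=1..D. of_nat (c d) * f d)
      - (\<Sum>d=1..D. f d / (of_nat d * of_nat (d + 1))) * of_real x" "\<Sum>n\<in>{n\<in>I. q n \<notin> {1..D}}. f (q n)"]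
    by (simp add: q_def algebra_simps)
qed

text \<open>
  Let \<open>m = \<lfloor>x / n\<rfloor>\<close>. Cauchy-Schwarz for \<open>a m = (a m m\<^bsup>-s/2\<^esup>) m\<^bsup>s/2\<^esup>\<close> gives two factors. As the quotients
  are distinct, the first is at most the whole series \<open>\<Sum> (a m)\<^sup>2 m\<^bsup>-s\<^esup>\<close>. For the second,
  \<open>m\<^bsup>s\<^esup> \<le> x\<^bsup>s\<^esup> n\<^bsup>t - s\<^esup> n\<^bsup>-t\<^esup>\<close>, where \<open>n\<^bsup>t - s\<^esup>\<close> is at most \<open>x\<^bsup>(t - s)/2\<^esup>\<close> and \<open>n\<^bsup>-t\<^esup>\<close> is summable.
\<close>

lemma large_quotients_bound:
  fixes a :: "nat \<Rightarrow> real" and x :: real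
  assumes summ: "summable (\<lambda>m. (a m)\<^sup>2 * real m powr (-s))" and nonneg: "\<And>m. a m \<ge> 0"
    and st: "0 \<le> s" "s \<le> t" "t > 1" and x: "x \<ge> 1"
  shows "(\<Sum>n | 1 \<le> n \<and> real n < sqrt x. a (nat \<lfloor>x / real n\<rfloor>))
    \<le> sqrt ((\<Sum>m. (a m)\<^sup>2 * real m powr (-s)) * (\<Sum>n. real n powr (-t))) * x powr ((s + t) / 4)"
    (is "_ \<le> sqrt (?T * ?Z) * _")
proof (rule power2_le_imp_le)
  define B where "B = {n. 1 \<le> n \<and> real n < sqrt x}"
  define q where "q = (\<lambda>n. nat \<lfloor>x / real n\<rfloor>)"
  have finB: "finite B" unfolding B_def
    by (rule finite_subset[of _ "{..nat \<lceil>sqrt x\<rceil>}"]) (auto, linarith)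
  have sZ: "summable (\<lambda>n. real n powr (-t))"
    using st by (subst summable_real_powr_iff) auto
  have T: "?T \<ge> 0" and Z: "?Z \<ge> 0"
    using summ sZ by (auto intro!: suminf_nonneg)
  have q_pos: "q n \<ge> 1" and q_le: "real (q n) \<le> x / real n" if "n \<in> B" for n
  proof -
    have "sqrt x \<le> x" using x by (simp add: real_le_lsqrt power2_eq_square)
    hence "x / real n \<ge> 1" using that by (simp add: B_def)
    thus "q n \<ge> 1" unfolding q_def by (simp add: le_nat_iff)
    show "real (q n) \<le> x / real n" unfolding q_def using x by (simp add: of_nat_nat)
  qed
  have "(\<Sum>n\<in>B. a (q n))\<^sup>2 =
     (\<Sum>n\<in>B. (a (q n) * real (q n) powr (-s/2)) * real (q n) powr (s/2))\<^sup>2"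
    using q_pos by (intro arg_cong[of _ _ "\<lambda>y. y\<^sup>2"] sum.cong)
      (fastforce simp: powr_minus simp flip: powr_add)+
  also have "\<dots> \<le> (\<Sum>n\<in>B. (a (q n) * real (q n) powr (-s/2))\<^sup>2) * (\<Sum>n\<in>B. (real (q n) powr (s/2))\<^sup>2)"
    by (rule Cauchy_Schwarz_ineq_sum)
  also have "\<dots> = (\<Sum>n\<in>B. (a (q n))\<^sup>2 * real (q n) powr (-s)) * (\<Sum>n\<in>B. real (q n) powr s)"
  proof -
    have "(real k powr r)\<^sup>2 = real k powr (2 * r)" for k :: nat and r :: real
      by (simp add: power2_eq_square flip: powr_add)
    thus ?thesis by (simp add: power_mult_distrib)
  qed
  also have "\<dots> \<le> ?T * (x powr ((s + t) / 2) * ?Z)"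
  proof (rule mult_mono)
    have "(\<Sum>n\<in>B. (a (q n))\<^sup>2 * real (q n) powr (-s)) = (\<Sum>m\<in>q ` B. (a m)\<^sup>2 * real m powr (-s))"
      using inj_on_floor_quotient[of x] by (subst sum.reindex) (auto simp: q_def B_def)
    also have "\<dots> \<le> ?T"
      using finB by (intro sum_le_suminf summ) auto
    finally show "(\<Sum>n\<in>B. (a (q n))\<^sup>2 * real (q n) powr (-s)) \<le> ?T" .
  next
    have "(\<Sum>n\<in>B. real (q n) powr s) \<le> (\<Sum>n\<in>B. x powr ((s + t) / 2) * real n powr (-t))"
    proof (rule sum_mono)
      fix n assume n: "n \<in> B"
      have "real (q n) powr s \<le> (x / real n) powr s"
        using q_le[OF n] st by (intro powr_mono2) auto
      also have "\<dots> = x powr s * (real n powr (t - s) * real n powr (-t))"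
        using n x by (simp add: powr_divide powr_minus_divide powr_diff B_def)
      also have "\<dots> \<le> x powr s * ((sqrt x) powr (t - s) * real n powr (-t))"
        using n st by (intro mult_left_mono mult_right_mono powr_mono2) (auto simp: B_def)
      also have "sqrt x powr (t - s) = x powr ((t - s) / 2)"
        using x by (simp add: powr_half_sqrt[symmetric] powr_powr)
      also have "x powr s * (x powr ((t - s) / 2) * real n powr (-t))
          = x powr (s + (t - s) / 2) * real n powr (-t)"
        by (simp add: powr_add)
      also have "s + (t - s) / 2 = (s + t) / 2" by (simp add: field_simps)
      finally show "real (q n) powr s \<le> x powr ((s + t) / 2) * real n powr (-t)" .
    qed
    also have "\<dots> = x powr ((s + t) / 2) * (\<Sum>n\<in>B. real n powr (-t))"
      by (simp add: sum_distrib_left)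
    also have "\<dots> \<le> x powr ((s + t) / 2) * ?Z"
      using finB by (intro mult_left_mono sum_le_suminf sZ) auto
    finally show "(\<Sum>n\<in>B. real (q n) powr s) \<le> x powr ((s + t) / 2) * ?Z" .
  qed (use T in \<open>auto intro!: sum_nonneg\<close>)
  also have "\<dots> = (sqrt (?T * ?Z) * x powr ((s + t) / 4))\<^sup>2"
  proof -
    have "x powr ((s + t) / 2) = (x powr ((s + t) / 4))\<^sup>2"
      by (simp add: power2_eq_square flip: powr_add)
    moreover have "(sqrt (?T * ?Z))\<^sup>2 = ?T * ?Z"
      by (rule real_sqrt_pow2) (use T Z in simp)
    ultimately show ?thesis by (simp only: power_mult_distrib mult_ac)
  qed
  finally show "(\<Sum>n | 1 \<le> n \<and> real n < sqrt x. a (nat \<lfloor>x / real n\<rfloor>))\<^sup>2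
    \<le> (sqrt (?T * ?Z) * x powr ((s + t) / 4))\<^sup>2"
    unfolding B_def q_def .
  show "sqrt (?T * ?Z) * x powr ((s + t) / 4) \<ge> 0" using T Z by simp
qed

section \<open>The tail of the main coefficient\<close>

text \<open>
  The parameter \<open>y\<close> serves two purposes: \<open>y = 1\<close> gives convergence of the series, and \<open>y\<close> of the
  size of the first index gives the saving \<open>y\<^bsup>s - 2\<^esup>\<close> in its tail.
\<close>

lemma norm_main_coeff_term_le:
  assumes "s \<le> 2" "0 < y" "y \<le> real (n + 1)"
  shows "cmod (main_coeff_term f n) \<le> y powr (s - 2) * (cmod (f (n + 1)) * real (n + 1) powr (-s))"
proof -
  have "cmod (main_coeff_term f n) = cmod (f (n + 1)) / (real (n + 1) * real (n + 2))"
    unfolding main_coeff_term_def norm_divide norm_mult norm_of_nat ..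
  also have "\<dots> \<le> cmod (f (n + 1)) / (real (n + 1) * real (n + 1))"
    by (intro divide_left_mono mult_left_mono) auto
  also have "\<dots> = cmod (f (n + 1)) * (real (n + 1) powr (s - 2) * real (n + 1) powr (-s))"
  proof -
    have "real (n + 1) powr (s - 2) * real (n + 1) powr (-s) = real (n + 1) powr (-2)"
      by (simp flip: powr_add)
    also have "\<dots> = 1 / (real (n + 1) * real (n + 1))"
      by (simp add: powr_minus_divide power2_eq_square)
    finally show ?thesis by simp
  qed
  also have "\<dots> \<le> cmod (f (n + 1)) * (y powr (s - 2) * real (n + 1) powr (-s))"
    using assms by (intro mult_left_mono mult_right_mono powr_mono2') auto
  finally show ?thesis by (simp add: mult_ac)
qed

lemma summable_main_coeff_term:
  assumes "summable (\<lambda>m. cmod (f m) * real m powr (-s))" "s \<le> 2"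
  shows "summable (\<lambda>n. cmod (main_coeff_term f n))"
proof (rule summable_comparison_test')
  show "summable (\<lambda>n. cmod (f (n + 1)) * real (n + 1) powr (-s))"
    using assms(1) by (subst (asm) summable_iff_shift[symmetric, of _ 1])
  show "norm (cmod (main_coeff_term f n)) \<le> cmod (f (n + 1)) * real (n + 1) powr (-s)" for n
    using norm_main_coeff_term_le[of s 1 n f] assms by simp
qed

lemma main_coeff_tail_bound:
  fixes y :: real
  assumes summ: "summable (\<lambda>m. cmod (f m) * real m powr (-s))" and "s \<le> 2" 
    and y: "0 < y" "y \<le> real D + 1"
  shows "cmod (main_coeff f - (\<Sum>d=1..D. f d / (of_nat d * of_nat (d + 1))))
    \<le> y powr (s - 2) * (\<Sum>m. cmod (f m) * real m powr (-s))"
proof -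
  define g where "g = (\<lambda>m. cmod (f m) * real m powr (-s))"
  note abs = summable_main_coeff_term[OF summ \<open>s \<le> 2\<close>]
  have sg: "summable (\<lambda>n. g (n + (D + 1)))"
    using summ unfolding g_def[symmetric] by (subst summable_iff_shift)
  have "(\<Sum>d=1..D. f d / (of_nat d * of_nat (d + 1))) = (\<Sum>n<D. main_coeff_term f n)"
    by (simp add: main_coeff_term_def sum.atLeast1_atMost_eq)
  hence "main_coeff f - (\<Sum>d=1..D. f d / (of_nat d * of_nat (d + 1))) = (\<Sum>n. main_coeff_term f (n + D))"
    using suminf_split_initial_segment[OF summable_norm_cancel[OF abs], of D]
    by (simp add: main_coeff_def)
  also have "cmod \<dots> \<le> (\<Sum>n. cmod (main_coeff_term f (n + D)))"
    using abs by (intro summable_norm) (subst summable_iff_shift[of "\<lambda>n. cmod (main_coeff_term f n)"])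
  also have "\<dots> \<le> (\<Sum>n. y powr (s - 2) * g (n + (D + 1)))"
  proof (rule suminf_le)
    show "cmod (main_coeff_term f (n + D)) \<le> y powr (s - 2) * g (n + (D + 1))" for n
      using norm_main_coeff_term_le[of s y "n + D" f] y \<open>s \<le> 2\<close> by (simp add: g_def)
    show "summable (\<lambda>n. cmod (main_coeff_term f (n + D)))"
      using abs by (subst summable_iff_shift[of "\<lambda>n. cmod (main_coeff_term f n)"])
    show "summable (\<lambda>n. y powr (s - 2) * g (n + (D + 1)))"
      by (intro summable_mult sg)
  qed
  also have "\<dots> = y powr (s - 2) * (\<Sum>n. g (n + (D + 1)))"
    by (rule suminf_mult[OF sg])
  also have "\<dots> \<le> y powr (s - 2) * (\<Sum>m. g m)"
  proof (rule mult_left_mono)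
    have "(\<Sum>m<D + 1. g m) \<ge> 0" by (intro sum_nonneg) (simp add: g_def)
    thus "(\<Sum>n. g (n + (D + 1))) \<le> (\<Sum>m. g m)"
      using suminf_split_initial_segment[OF summ, of "D + 1"] by (simp add: g_def)
  qed auto
  finally show ?thesis by (simp add: g_def)
qed

section \<open>The asymptotic formula\<close>

theorem theorem1p1:
  fixes f :: "nat \<Rightarrow> complex" and \<eta> :: real
  assumes "0 < \<eta>" and "\<eta> < 2"
    and "(\<lambda>x::real. \<Sum>n\<in>{1..nat \<lfloor>x\<rfloor>}. (cmod (f n))\<^sup>2) \<in> O[at_top](\<lambda>x. x powr \<eta>)"
  shows "summable (main_coeff_term f) \<and>
         (\<lambda>x::real. cmod (floor_quotient_sum f x - main_coeff f * of_real x))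
           \<in> O[at_top](\<lambda>x. x powr ((2 + 3 * \<eta>) / 8))"
proof -
  define e where "e = (2 + 3 * \<eta>) / 8"
  obtain K where K: "K \<ge> 0"
    "\<And>n. n \<ge> 1 \<Longrightarrow> (\<Sum>m=1..n. (cmod (f m))\<^sup>2) \<le> K * real n powr \<eta>"
    using partial_sum_bound_of_bigo[of "\<lambda>m. (cmod (f m))\<^sup>2" \<eta>] assms by auto
  have first: "(\<Sum>m=1..n. cmod (f m)) \<le> sqrt K * real n powr ((1 + \<eta>) / 2)" if "n \<ge> 1" for n
    using K that by (intro first_moment_le) auto
  \<comment> \<open>The conditions on \<open>s\<close> and \<open>t\<close> are \<open>\<eta> < s \<le> t\<close>, \<open>1 < t\<close> and \<open>s + t = 1 + 3\<eta>/2\<close>, so that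
    \<open>large_quotients_bound\<close> yields the exponent \<open>e\<close>. For \<open>\<eta> > 1\<close> the equal values \<open>s = t\<close> work;
    for small \<open>\<eta>\<close> they would violate \<open>t > 1\<close>, and the excess \<open>\<eta>/2\<close> of \<open>s + t\<close> over \<open>\<eta> + 1\<close> is shared
    evenly instead.\<close>
  define s t where "s = (if \<eta> \<le> 1 then 5 * \<eta> / 4 else 2 * e)"
    and "t = (if \<eta> \<le> 1 then 1 + \<eta> / 4 else 2 * e)"
  have st: "\<eta> < s" "s \<le> t" "1 < t" "(s + t) / 4 = e"
    using assms by (auto simp: s_def t_def e_def field_simps)
  have summ2: "summable (\<lambda>m. (cmod (f m))\<^sup>2 * real m powr (-s))"
    by (rule summable_weighted_of_partial_sum_bound[OF _ K(2)]) (use assms st in auto)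
  \<comment> \<open>\<open>2 * e = 1/2 + 3\<eta>/4\<close> exceeds the first moment exponent \<open>(1 + \<eta>)/2\<close>. A saving of
    \<open>(\<surd>x)\<^bsup>2e - 2\<^esup> = x\<^bsup>e - 1\<^esup>\<close> in the tail is exactly what the error term asks for.\<close>
  have summ1: "summable (\<lambda>m. cmod (f m) * real m powr (-(2 * e)))"
    by (rule summable_weighted_of_partial_sum_bound[OF _ first]) (use assms in \<open>auto simp: e_def\<close>)
  have e2: "2 * e \<le> 2" using assms by (simp add: e_def)
  define C where "C = sqrt ((\<Sum>m. (cmod (f m))\<^sup>2 * real m powr (-s)) * (\<Sum>n. real n powr (-t)))"
  define G where "G = (\<Sum>m. cmod (f m) * real m powr (-(2 * e)))"
  have bound: "cmod (floor_quotient_sum f x - main_coeff f * of_real x) \<le> (sqrt K + C + G) * x powr e"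
    if x: "x \<ge> 1" for x
  proof -
    define D where "D = nat \<lfloor>sqrt x\<rfloor>"
    have sqrt1: "sqrt x \<ge> 1" using x by simp
    have D: "D \<ge> 1" "real D \<le> sqrt x" "sqrt x < real D + 1"
      using sqrt1 by (auto simp: D_def le_nat_iff of_nat_nat)
    define P where "P = (\<Sum>d=1..D. f d / (of_nat d * of_nat (d + 1)))"
    have "(\<Sum>d=1..D. cmod (f d)) \<le> sqrt K * real D powr ((1 + \<eta>) / 2)"
      by (rule first[OF D(1)])
    also have "\<dots> \<le> sqrt K * sqrt x powr ((1 + \<eta>) / 2)"
      using D K assms by (intro mult_left_mono powr_mono2) auto
    also have "sqrt x powr ((1 + \<eta>) / 2) = x powr ((1 + \<eta>) / 4)"
      using x by (simp add: powr_half_sqrt[symmetric] powr_powr)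
    also have "sqrt K * x powr ((1 + \<eta>) / 4) \<le> sqrt K * x powr e"
      using x K assms by (intro mult_left_mono powr_mono) (auto simp: e_def)
    finally have 1: "(\<Sum>d=1..D. cmod (f d)) \<le> sqrt K * x powr e" .
    have 2: "(\<Sum>n | 1 \<le> n \<and> real n < sqrt x. cmod (f (nat \<lfloor>x / real n\<rfloor>))) \<le> C * x powr e"
      using large_quotients_bound[OF summ2 _ _ st(2,3) x] st assms by (simp add: C_def)
    have "cmod (P * of_real x - main_coeff f * of_real x) = cmod (main_coeff f - P) * x"
      using x by (simp flip: left_diff_distrib add: norm_mult norm_minus_commute)
    also have "\<dots> \<le> (sqrt x powr (2 * e - 2) * G) * x"
      unfolding P_def G_def using D sqrt1 x
      by (intro mult_right_mono main_coeff_tail_bound summ1 e2) auto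
    also have "sqrt x powr (2 * e - 2) = x powr (e - 1)"
      using x by (simp add: powr_half_sqrt[symmetric] powr_powr diff_divide_distrib)
    also have "x powr (e - 1) * G * x = G * x powr e"
      using x by (simp add: powr_diff)
    finally have 3: "cmod (P * of_real x - main_coeff f * of_real x) \<le> G * x powr e" .
    have "cmod (floor_quotient_sum f x - main_coeff f * of_real x)
      \<le> cmod (floor_quotient_sum f x - P * of_real x) + cmod (P * of_real x - main_coeff f * of_real x)"
      using norm_triangle_ineq[of "floor_quotient_sum f x - P * of_real x"
          "P * of_real x - main_coeff f * of_real x"] by simp
    thus ?thesis
      using 1 2 3 floor_quotient_sum_approx[OF x D(3), of f] unfolding P_def[symmetric]
      by (simp add: distrib_right)
  qed
  have "(\<lambda>x::real. cmod (floor_quotient_sum f x - main_coeff f * of_real x)) \<in> O[at_top](\<lambda>x. x powr e)"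
    by (rule bigoI[of _ "sqrt K + C + G"])
      (use bound in \<open>auto simp: eventually_at_top_linorder intro!: exI[of _ 1]\<close>)
  thus ?thesis
    using summable_norm_cancel[OF summable_main_coeff_term[OF summ1 e2]] by (simp add: e_def)
qed

end
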